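(* Let $A=(a_{jk})_{j,k=1}^\infty$ be an infinite matrix with complex entries. Under the standard inner product for $\ell^2$, the Berezin range $\mathrm{Ber}(A)$ is a convex subset of $\mathbb{C}$ if and only if $A$ has constant diagonal, i.e. $a_{jj}=a_{kk}$ for all $j,k\ge 1$.
   Context: $\ell^2$ is regarded as a reproducing kernel Hilbert space of functions $v:X\to\mathbb{C}$, $v(j)=v_j$, on $X=\{1,2,\dots\}$, with reproducing kernel at $j$ equal to the $j$-th standard basis vector $e_j$, which is already normalized. The Berezin range of $A$ is accordingly $\mathrm{Ber}(A)=\{\langle Ae_j,e_j\rangle : j=1,2,\dots\}=\{a_{jj}: j=1,2,\dots\}$. *)

theory Defs
  imports "HOL-Analysis.Analysis"
begin

text \<open>
  A Hilbert space of complex functions on a set \<open>X\<close> is given by its carrier \<open>H\<close> and its inner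
  product \<open>ip\<close> (linear in the first argument). When \<open>X\<close> is not the whole type, functions are
  taken to vanish outside \<open>X\<close>, so that distinct elements of \<open>H\<close> are distinct functions on \<open>X\<close>.
\<close>

definition is_reproducing_kernel ::
  "('x \<Rightarrow> complex) set \<Rightarrow> (('x \<Rightarrow> complex) \<Rightarrow> ('x \<Rightarrow> complex) \<Rightarrow> complex) \<Rightarrow> 'x \<Rightarrow> ('x \<Rightarrow> complex) \<Rightarrow> bool"
  where "is_reproducing_kernel H ip x k \<longleftrightarrow> k \<in> H \<and> (\<forall>f\<in>H. f x = ip f k)"

definition ip_normalize ::
  "(('x \<Rightarrow> complex) \<Rightarrow> ('x \<Rightarrow> complex) \<Rightarrow> complex) \<Rightarrow> ('x \<Rightarrow> complex) \<Rightarrow> ('x \<Rightarrow> complex)"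
  where "ip_normalize ip k = (\<lambda>y. k y / of_real (sqrt (Re (ip k k))))"

text \<open>
  The reproducing kernel at a point is unique, so quantifying over all kernels at \<open>x\<close> below
  contributes exactly one value for each \<open>x\<close>.
\<close>

definition berezin_range ::
  "'x set \<Rightarrow> ('x \<Rightarrow> complex) set \<Rightarrow> (('x \<Rightarrow> complex) \<Rightarrow> ('x \<Rightarrow> complex) \<Rightarrow> complex)
    \<Rightarrow> (('x \<Rightarrow> complex) \<Rightarrow> ('x \<Rightarrow> complex)) \<Rightarrow> complex set"
  where "berezin_range X H ip T =
    {ip (T (ip_normalize ip k)) (ip_normalize ip k) | x k. x \<in> X \<and> is_reproducing_kernel H ip x k}"

text \<open>Indices run over the positive integers; the value at \<open>0\<close> is fixed to \<open>0\<close>.\<close>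

definition ell2 :: "(nat \<Rightarrow> complex) set"
  where "ell2 = {v. v 0 = 0 \<and> (\<lambda>j. (cmod (v j))\<^sup>2) summable_on {1..}}"

definition ell2_inner :: "(nat \<Rightarrow> complex) \<Rightarrow> (nat \<Rightarrow> complex) \<Rightarrow> complex"
  where "ell2_inner v w = (\<Sum>\<^sub>\<infinity>j\<in>{1..}. v j * cnj (w j))"

text \<open>
  No boundedness is imposed on the matrix, so \<open>matrix_apply A v\<close> need not lie in \<open>ell2\<close>.
  For \<open>v\<close> a standard basis vector both the sum below and the inner product of
  \<open>matrix_apply A v\<close> with \<open>v\<close> have at most one nonzero term, hence always converge. Entries of \<open>A\<close>
  with an index \<open>0\<close> play no role.
\<close>

definition matrix_apply :: "(nat \<Rightarrow> nat \<Rightarrow> complex) \<Rightarrow> (nat \<Rightarrow> complex) \<Rightarrow> (nat \<Rightarrow> complex)"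
  where "matrix_apply A v = (\<lambda>j. if j = 0 then 0 else (\<Sum>\<^sub>\<infinity>k\<in>{1..}. A j k * v k))"

definition Ber :: "(nat \<Rightarrow> nat \<Rightarrow> complex) \<Rightarrow> complex set"
  where "Ber A = berezin_range {1..} ell2 ell2_inner (matrix_apply A)"

end

theory Submission imports Defs begin

text \<open>Pairing with a standard basis vector reads off a coordinate, so the kernel at
  \<open>x\<close> is exactly \<open>unit_vec x\<close>, already of norm 1
  (\<open>is_reproducing_kernel_ell2_iff\<close>, \<open>ip_normalize_unit_vec\<close>). Hence
  \<open>Ber A\<close> is the set of diagonal entries (\<open>Ber_eq_diagonal\<close>). This set is
  countable and nonempty, and a countable convex set has at most one point.\<close>

definition unit_vec :: "nat \<Rightarrow> nat \<Rightarrow> complex"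
  where "unit_vec x = (\<lambda>j. of_bool (j = x))"

text \<open>Dropping zero terms changes neither convergence nor value, so sums against basis vectors
  can be evaluated for an arbitrary matrix.\<close>

lemma infsum_eq_single:
  fixes f :: "'a \<Rightarrow> 'b::{comm_monoid_add, t2_space}"
  assumes "x \<in> S" and "\<And>j. j \<in> S \<Longrightarrow> j \<noteq> x \<Longrightarrow> f j = 0"
  shows "infsum f S = f x"
proof -
  have "infsum f S = infsum f {x}"
    using assms by (intro infsum_cong_neutral) auto
  then show ?thesis by simp
qed

text \<open>Here \<open>v\<close> is any function: it will be a column of \<open>A\<close>, which
  may fail to be square summable.\<close>

lemma ell2_inner_unit_vec_right:
  assumes "x \<ge> 1"
  shows "ell2_inner v (unit_vec x) = v x"
  unfolding ell2_inner_def using assms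
  by (subst infsum_eq_single[where x = x]) (auto simp: unit_vec_def)

lemma ell2_inner_unit_vec_left:
  assumes "x \<ge> 1"
  shows "ell2_inner (unit_vec x) v = cnj (v x)"
  unfolding ell2_inner_def using assms
  by (subst infsum_eq_single[where x = x]) (auto simp: unit_vec_def)

lemma matrix_apply_unit_vec:
  assumes "x \<ge> 1" and "j \<ge> 1"
  shows "matrix_apply A (unit_vec x) j = A j x"
  unfolding matrix_apply_def using assms
  by (subst infsum_eq_single[where x = x]) (auto simp: unit_vec_def)

lemma unit_vec_in_ell2:
  assumes "x \<ge> 1"
  shows "unit_vec x \<in> ell2"
proof -
  have "(\<lambda>j. (cmod (unit_vec x j))\<^sup>2) summable_on {1..}
      \<longleftrightarrow> (\<lambda>j. (cmod (unit_vec x j))\<^sup>2) summable_on {x}"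
    using assms by (intro summable_on_cong_neutral) (auto simp: unit_vec_def)
  then show ?thesis using assms by (auto simp: ell2_def unit_vec_def)
qed

text \<open>Testing the reproducing property on each \<open>unit_vec j\<close> determines every
  coordinate of \<open>k\<close>, which gives uniqueness.\<close>

lemma is_reproducing_kernel_ell2_iff:
  assumes "x \<ge> 1"
  shows "is_reproducing_kernel ell2 ell2_inner x k \<longleftrightarrow> k = unit_vec x"
proof
  assume k: "is_reproducing_kernel ell2 ell2_inner x k"
  show "k = unit_vec x"
  proof
    fix j
    show "k j = unit_vec x j"
    proof (cases "j = 0")
      case True
      \<comment> \<open>No basis vector tests index 0; there the convention \<open>v 0 = 0\<close>
        in \<open>ell2\<close> fixes the value.\<close>
      then show ?thesis
        using k assms by (simp add: is_reproducing_kernel_def ell2_def unit_vec_def)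
    next
      case False
      then have j: "j \<ge> 1" by simp
      have "unit_vec j x = ell2_inner (unit_vec j) k"
        using k unit_vec_in_ell2[OF j] by (simp add: is_reproducing_kernel_def)
      also have "\<dots> = cnj (k j)" by (rule ell2_inner_unit_vec_left[OF j])
      finally have "k j = cnj (unit_vec j x)" by simp
      \<comment> \<open>The entries are 0 or 1, hence real, and symmetric in \<open>j\<close> and
        \<open>x\<close>.\<close>
      then show ?thesis by (auto simp: unit_vec_def)
    qed
  qed
next
  assume "k = unit_vec x"
  then show "is_reproducing_kernel ell2 ell2_inner x k"
    using assms by (simp add: is_reproducing_kernel_def unit_vec_in_ell2 ell2_inner_unit_vec_right)
qed

lemma ip_normalize_unit_vec:
  assumes "x \<ge> 1"
  shows "ip_normalize ell2_inner (unit_vec x) = unit_vec x"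
  unfolding ip_normalize_def ell2_inner_unit_vec_right[OF assms] by (simp add: unit_vec_def)

lemma Ber_eq_diagonal: "Ber A = (\<lambda>j. A j j) ` {1..}"
proof -
  let ?e = "\<lambda>x. ip_normalize ell2_inner (unit_vec x)"
  have "Ber A = (\<lambda>x. ell2_inner (matrix_apply A (?e x)) (?e x)) ` {1..}"
    unfolding Ber_def berezin_range_def image_def Bex_def atLeast_iff
    \<comment> \<open>Uniqueness of the kernel eliminates the quantifier over
      \<open>k\<close>.\<close>
    by (intro Collect_cong) (metis is_reproducing_kernel_ell2_iff)
  also have "\<dots> = (\<lambda>j. A j j) ` {1..}"
    by (rule image_cong)
      (simp_all add: ip_normalize_unit_vec ell2_inner_unit_vec_right matrix_apply_unit_vec)
  finally show ?thesis .
qed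

text \<open>The Berezin range is the countable set of diagonal entries, whereas a connected set with two
  distinct points is uncountable.\<close>

theorem proposition3p1:
  fixes A :: "nat \<Rightarrow> nat \<Rightarrow> complex"
  shows "convex (Ber A) \<longleftrightarrow> (\<forall>j\<ge>1. \<forall>k\<ge>1. A j j = A k k)"
proof
  assume "convex (Ber A)"
  then have "connected (Ber A)" by (rule convex_connected)
  moreover have "countable (Ber A)" unfolding Ber_eq_diagonal by simp
  ultimately have "a = b" if "a \<in> Ber A" "b \<in> Ber A" for a b
    using connected_uncountable that by blast
  then show "\<forall>j\<ge>1. \<forall>k\<ge>1. A j j = A k k" by (auto simp: Ber_eq_diagonal)
next
  assume "\<forall>j\<ge>1. \<forall>k\<ge>1. A j j = A k k"
  then have diag: "A j j = A 1 1" if "j \<in> {1..}" for j using that by (metis atLeast_iff order_refl)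
  \<comment> \<open>A constant image of a nonempty index set is a single point, hence
    convex.\<close>
  have "Ber A = (\<lambda>j::nat. A 1 1) ` {1..}"
    unfolding Ber_eq_diagonal by (rule image_cong[OF refl diag])
  then show "convex (Ber A)" by (simp add: image_constant_conv)
qed

end
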